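(* Let $\langle F,E\rangle$ be a weak-$^*$ sequentially complete anti-dual pair, let $\operatorname{dom} S_0\subseteq E$ be a linear subspace, and let $S_0:\operatorname{dom} S_0\to F$ be a symmetric linear operator, i.e., $$\langle S_0x,y\rangle=\overline{\langle S_0y,x\rangle},\qquad x,y\in \operatorname{dom} S_0.$$ Suppose that $S_0$ is $A$-bounded with some positive operator $A\in\mathscr{L}(E,F)$. Then there exist two (distinguished) self-adjoint extensions $S_m,S_M\in\mathscr{L}(E,F)$ of $S_0$ such that $$\alpha_A(S_m)=\alpha_A(S_M)=\alpha_A(S_0).$$ In fact, the interval $[S_m,S_M]$ consists exactly of all self-adjoint extensions $S\supset S_0$ such that $\alpha_A(S)=\alpha_A(S_0)$: $$[S_m,S_M]=\{S\in\mathscr{L}(E,F)\;:\;S_0\subset S=S^*,\ \alpha_A(S)=\alpha_A(S_0)\}.$$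
   Context: An anti-dual pair $\langle F,E\rangle$ consists of two complex vector spaces $E,F$ together with a separating sesquilinear map $\langle\cdot,\cdot\rangle:F\times E\to\mathbb{C}$, linear in the first and conjugate linear in the second variable (separating: if $\langle f,x\rangle=0$ for all $x\in E$ then $f=0$, and if $\langle f,x\rangle=0$ for all $f\in F$ then $x=0$). The weak topology $\sigma(E,F)$ on $E$ is the one induced by the functionals $\langle f,\cdot\rangle$, $f\in F$, and the topology $\sigma(F,E)$ on $F$ is the one induced by the functionals $\langle\cdot,x\rangle$, $x\in E$. The pair is called weak-$^*$ sequentially complete if $(F,\sigma(F,E))$ is sequentially complete. $\mathscr{L}(E,F)$ denotes the set of everywhere defined linear operators $T:E\to F$ that are $\sigma(E,F)$-$\sigma(F,E)$ continuous. For $T\in\mathscr{L}(E,F)$ the adjoint $T^*\in\mathscr{L}(E,F)$ is determined by $\langle Tx,y\rangle=\overline{\langle T^*y,x\rangle}$ for $x,y\in E$; $T$ is self-adjoint if $T^*=T$. A linear operator $A:E\to F$ is positive if $\langle Ax,x\rangle\ge 0$ for all $x\in E$. (Everywhere defined symmetric operators, in particular everywhere defined positive operators, are automatically weakly continuous and self-adjoint.) For self-adjoint $S,T\in\mathscr{L}(E,F)$, $S\le T$ means that $T-S$ is positive, and $[S_m,S_M]$ denotes the set of self-adjoint $S\in\mathscr{L}(E,F)$ with $S_m\le S\le S_M$. $S_0\subset S$ means that $S$ extends $S_0$. Given a positive operator $A\in\mathscr{L}(E,F)$, a symmetric operator $S_0:E\supseteq\operatorname{dom}S_0\to F$ is called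 $A$-bounded if there is a constant $\alpha\ge 0$ with $$|\langle S_0x,y\rangle|^2\le\alpha^2\,\langle Ax,x\rangle\langle Ay,y\rangle,\qquad x\in\operatorname{dom}S_0,\ y\in E.$$ The smallest such constant $\alpha$ is the $A$-bound of $S_0$, denoted $\alpha_A(S_0)$. The same definition applies to everywhere defined operators ($\operatorname{dom}S=E$); the condition $\alpha_A(S)=\alpha_A(S_0)$ includes that $S$ is $A$-bounded. *)

theory Defs
  imports "HOL-Analysis.Analysis" "HOL-Library.Complex_Order"
begin

section \<open>Anti-dual pairs and their weak topologies\<close>

text \<open>The two complex vector spaces are whole types, with scalar multiplications \<open>sE\<close> and \<open>sF\<close>;
  the pairing takes its linear argument (from \<open>F\<close>) first.\<close>

locale anti_dual_pair = E: vector_space sE + F: vector_space sF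
  for sE :: "complex \<Rightarrow> 'e::ab_group_add \<Rightarrow> 'e"
    and sF :: "complex \<Rightarrow> 'f::ab_group_add \<Rightarrow> 'f" +
  fixes p :: "'f \<Rightarrow> 'e \<Rightarrow> complex"
  assumes add_left: "p (f + g) x = p f x + p g x"
    and scale_left: "p (sF c f) x = c * p f x"
    and add_right: "p f (x + y) = p f x + p f y"
    and scale_right: "p f (sE c x) = cnj c * p f x"
    and separating_F: "(\<And>x. p f x = 0) \<Longrightarrow> f = 0"
    and separating_E: "(\<And>f. p f x = 0) \<Longrightarrow> x = 0"

definition initial_topology :: "('a \<Rightarrow> complex) set \<Rightarrow> 'a topology" where
  "initial_topology \<Phi> = topology_generated_by {\<phi> -` U |\<phi> U. \<phi> \<in> \<Phi> \<and> open U}"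

definition sigma_EF :: "('f \<Rightarrow> 'e \<Rightarrow> complex) \<Rightarrow> 'e topology" where
  "sigma_EF p = initial_topology (range (\<lambda>f. \<lambda>x. p f x))"

definition sigma_FE :: "('f \<Rightarrow> 'e \<Rightarrow> complex) \<Rightarrow> 'f topology" where
  "sigma_FE p = initial_topology (range (\<lambda>x. \<lambda>f. p f x))"

text \<open>Cauchy sequences and sequential completeness refer to the uniformity of a group topology.\<close>

definition tvs_Cauchy :: "'a::ab_group_add topology \<Rightarrow> (nat \<Rightarrow> 'a) \<Rightarrow> bool" where
  "tvs_Cauchy X s \<longleftrightarrow>
     (\<forall>U. openin X U \<and> 0 \<in> U \<longrightarrow> (\<exists>N. \<forall>m\<ge>N. \<forall>n\<ge>N. s m - s n \<in> U))"

definition sequentially_complete :: "'a::ab_group_add topology \<Rightarrow> bool" where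
  "sequentially_complete X \<longleftrightarrow>
     (\<forall>s. tvs_Cauchy X s \<longrightarrow> (\<exists>l. limitin X s l sequentially))"

definition weak_star_sequentially_complete :: "('f::ab_group_add \<Rightarrow> 'e \<Rightarrow> complex) \<Rightarrow> bool" where
  "weak_star_sequentially_complete p \<longleftrightarrow> sequentially_complete (sigma_FE p)"


section \<open>Operators\<close>

text \<open>An operator with domain \<open>D\<close> is a total function of which only the values on \<open>D\<close> matter.\<close>

definition linear_operator_on ::
    "(complex \<Rightarrow> 'e::ab_group_add \<Rightarrow> 'e) \<Rightarrow> (complex \<Rightarrow> 'f::ab_group_add \<Rightarrow> 'f) \<Rightarrow>
     'e set \<Rightarrow> ('e \<Rightarrow> 'f) \<Rightarrow> bool" where
  "linear_operator_on sE sF D T \<longleftrightarrow>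
     (\<forall>x\<in>D. \<forall>y\<in>D. T (x + y) = T x + T y) \<and> (\<forall>c. \<forall>x\<in>D. T (sE c x) = sF c (T x))"

definition symmetric_on :: "('f \<Rightarrow> 'e \<Rightarrow> complex) \<Rightarrow> 'e set \<Rightarrow> ('e \<Rightarrow> 'f) \<Rightarrow> bool" where
  "symmetric_on p D T \<longleftrightarrow> (\<forall>x\<in>D. \<forall>y\<in>D. p (T x) y = cnj (p (T y) x))"

definition weakly_continuous_ops ::
    "(complex \<Rightarrow> 'e::ab_group_add \<Rightarrow> 'e) \<Rightarrow> (complex \<Rightarrow> 'f::ab_group_add \<Rightarrow> 'f) \<Rightarrow>
     ('f \<Rightarrow> 'e \<Rightarrow> complex) \<Rightarrow> ('e \<Rightarrow> 'f) set" where
  "weakly_continuous_ops sE sF p =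
     {T. Vector_Spaces.linear sE sF T \<and> continuous_map (sigma_EF p) (sigma_FE p) T}"

definition adjoint_op ::
    "(complex \<Rightarrow> 'e::ab_group_add \<Rightarrow> 'e) \<Rightarrow> (complex \<Rightarrow> 'f::ab_group_add \<Rightarrow> 'f) \<Rightarrow>
     ('f \<Rightarrow> 'e \<Rightarrow> complex) \<Rightarrow> ('e \<Rightarrow> 'f) \<Rightarrow> ('e \<Rightarrow> 'f)" where
  "adjoint_op sE sF p T =
     (THE R. R \<in> weakly_continuous_ops sE sF p \<and> (\<forall>x y. p (T x) y = cnj (p (R y) x)))"

definition self_adjoint ::
    "(complex \<Rightarrow> 'e::ab_group_add \<Rightarrow> 'e) \<Rightarrow> (complex \<Rightarrow> 'f::ab_group_add \<Rightarrow> 'f) \<Rightarrow>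
     ('f \<Rightarrow> 'e \<Rightarrow> complex) \<Rightarrow> ('e \<Rightarrow> 'f) \<Rightarrow> bool" where
  "self_adjoint sE sF p T \<longleftrightarrow> T \<in> weakly_continuous_ops sE sF p \<and> adjoint_op sE sF p T = T"

text \<open>The order on \<^typ>\<open>complex\<close> is the one of \<^theory>\<open>HOL-Library.Complex_Order\<close>:
  \<^prop>\<open>0 \<le> (z::complex)\<close> includes that \<open>z\<close> is real.\<close>

definition positive_op :: "('f \<Rightarrow> 'e \<Rightarrow> complex) \<Rightarrow> ('e \<Rightarrow> 'f) \<Rightarrow> bool" where
  "positive_op p A \<longleftrightarrow> (\<forall>x. 0 \<le> p (A x) x)"

definition op_le :: "('f::ab_group_add \<Rightarrow> 'e \<Rightarrow> complex) \<Rightarrow> ('e \<Rightarrow> 'f) \<Rightarrow> ('e \<Rightarrow> 'f) \<Rightarrow> bool" where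
  "op_le p S T \<longleftrightarrow> positive_op p (\<lambda>x. T x - S x)"

definition op_interval ::
    "(complex \<Rightarrow> 'e::ab_group_add \<Rightarrow> 'e) \<Rightarrow> (complex \<Rightarrow> 'f::ab_group_add \<Rightarrow> 'f) \<Rightarrow>
     ('f \<Rightarrow> 'e \<Rightarrow> complex) \<Rightarrow> ('e \<Rightarrow> 'f) \<Rightarrow> ('e \<Rightarrow> 'f) \<Rightarrow> ('e \<Rightarrow> 'f) set" where
  "op_interval sE sF p Sm SM = {S. self_adjoint sE sF p S \<and> op_le p Sm S \<and> op_le p S SM}"

definition extends_op :: "('e \<Rightarrow> 'f) \<Rightarrow> 'e set \<Rightarrow> ('e \<Rightarrow> 'f) \<Rightarrow> bool" where
  "extends_op S D S0 \<longleftrightarrow> (\<forall>x\<in>D. S x = S0 x)"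


section \<open>Boundedness relative to a positive operator\<close>

text \<open>For positive \<open>A\<close> the numbers \<open>p (A x) x\<close> are real, so \<^const>\<open>Re\<close> loses nothing here.\<close>

definition A_bound_const ::
    "('f \<Rightarrow> 'e \<Rightarrow> complex) \<Rightarrow> ('e \<Rightarrow> 'f) \<Rightarrow> 'e set \<Rightarrow> ('e \<Rightarrow> 'f) \<Rightarrow> real \<Rightarrow> bool" where
  "A_bound_const p A D S \<alpha> \<longleftrightarrow> 0 \<le> \<alpha> \<and>
     (\<forall>x\<in>D. \<forall>y. (cmod (p (S x) y))\<^sup>2 \<le> \<alpha>\<^sup>2 * Re (p (A x) x) * Re (p (A y) y))"

definition A_bounded ::
    "('f \<Rightarrow> 'e \<Rightarrow> complex) \<Rightarrow> ('e \<Rightarrow> 'f) \<Rightarrow> 'e set \<Rightarrow> ('e \<Rightarrow> 'f) \<Rightarrow> bool" where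
  "A_bounded p A D S \<longleftrightarrow> (\<exists>\<alpha>. A_bound_const p A D S \<alpha>)"

text \<open>The \<open>A\<close>-bound is meaningful only for \<open>A\<close>-bounded operators.\<close>

definition A_bound ::
    "('f \<Rightarrow> 'e \<Rightarrow> complex) \<Rightarrow> ('e \<Rightarrow> 'f) \<Rightarrow> 'e set \<Rightarrow> ('e \<Rightarrow> 'f) \<Rightarrow> real" where
  "A_bound p A D S = (LEAST \<alpha>. A_bound_const p A D S \<alpha>)"


section \<open>Adjoints and \<open>A\<close>-bounds are well defined\<close>

lemma A_bound_is_least:
  assumes "positive_op p A" "A_bounded p A D S"
  shows "A_bound_const p A D S (A_bound p A D S)"
    and "A_bound_const p A D S \<beta> \<Longrightarrow> A_bound p A D S \<le> \<beta>"
proof -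
  let ?M = "{\<alpha>. A_bound_const p A D S \<alpha>}"
  have M: "?M = {0..} \<inter> (\<Inter>x\<in>D. \<Inter>y.
      {\<alpha>. (cmod (p (S x) y))\<^sup>2 \<le> \<alpha>\<^sup>2 * Re (p (A x) x) * Re (p (A y) y)})"
    by (auto simp: A_bound_const_def)
  have "closed ?M"
    unfolding M by (intro closed_Int closed_atLeast closed_INT ballI closed_Collect_le continuous_intros)
  moreover have ne: "?M \<noteq> {}" using assms(2) by (simp add: A_bounded_def)
  moreover have bb: "bdd_below ?M" by (rule bdd_belowI[of _ 0]) (simp add: A_bound_const_def)
  ultimately have "Inf ?M \<in> ?M" by (intro closed_contains_Inf)
  moreover have le: "Inf ?M \<le> \<beta>" if "A_bound_const p A D S \<beta>" for \<beta>
    using that bb by (intro cInf_lower) auto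
  ultimately have eq: "A_bound p A D S = Inf ?M"
    unfolding A_bound_def by (intro Least_equality) auto
  show "A_bound_const p A D S (A_bound p A D S)"
    using \<open>Inf ?M \<in> ?M\<close> eq by simp
  show "A_bound_const p A D S \<beta> \<Longrightarrow> A_bound p A D S \<le> \<beta>"
    using le eq by simp
qed

lemma topspace_initial_topology: "\<Phi> \<noteq> {} \<Longrightarrow> topspace (initial_topology \<Phi>) = UNIV"
  unfolding initial_topology_def topology_generated_by_topspace by auto

lemma continuous_map_initial_iff:
  assumes "\<Phi> \<noteq> {}"
  shows "continuous_map X (initial_topology \<Phi>) g \<longleftrightarrow>
    (\<forall>\<phi>\<in>\<Phi>. continuous_map X euclidean (\<lambda>x. \<phi> (g x)))"
proof -
  have top: "\<Union>{\<phi> -` U |\<phi> U. \<phi> \<in> \<Phi> \<and> open U} = UNIV"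
    using topspace_initial_topology[OF assms]
    unfolding initial_topology_def topology_generated_by_topspace .
  have vimage: "g -` (\<phi> -` U) \<inter> topspace X = {x \<in> topspace X. \<phi> (g x) \<in> U}" for \<phi> U
    by auto
  have "continuous_map X (initial_topology \<Phi>) g \<longleftrightarrow>
      (\<forall>\<phi>\<in>\<Phi>. \<forall>U. open U \<longrightarrow> openin X (g -` (\<phi> -` U) \<inter> topspace X))"
    unfolding initial_topology_def continuous_on_generated_topo_iff top by blast
  then show ?thesis
    by (simp add: continuous_map_def vimage)
qed

lemma continuous_map_initial:
  "\<phi> \<in> \<Phi> \<Longrightarrow> continuous_map (initial_topology \<Phi>) euclidean \<phi>"
  using continuous_map_initial_iff[of \<Phi> "initial_topology \<Phi>" "\<lambda>x. x"] by auto

context anti_dual_pair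
begin

lemma zero_left: "p 0 x = 0"
  using add_left[of 0 0 x] by simp

lemma zero_right: "p f 0 = 0"
  using add_right[of f 0 0] by simp

lemma minus_left: "p (- f) x = - p f x"
  using add_left[of f "- f" x] by (simp add: zero_left add_eq_0_iff)

lemma diff_left: "p (f - g) x = p f x - p g x"
  using add_left[of f "- g" x] by (simp add: minus_left)

lemma left_eqI: "(\<And>x. p f x = p g x) \<Longrightarrow> f = g"
  using separating_F[of "f - g"] by (simp add: diff_left)

lemma kernel_representation:
  assumes "finite G"
    and "\<And>x y. \<phi> (x + y) = \<phi> x + \<phi> y" "\<And>c x. \<phi> (sE c x) = cnj c * \<phi> x"
    and "\<And>x. (\<And>f. f \<in> G \<Longrightarrow> p f x = 0) \<Longrightarrow> \<phi> x = 0"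
  shows "\<exists>f. \<forall>x. \<phi> x = p f x"
  using assms
proof (induction G arbitrary: \<phi> rule: finite_induct)
  case empty
  then show ?case by (auto intro!: exI[of _ 0] simp: zero_left)
next
  case (insert g G)
  show ?case
  proof (cases "\<forall>x. (\<forall>f\<in>G. p f x = 0) \<longrightarrow> p g x = 0")
    case True
    have "\<phi> x = 0" if "\<And>f. f \<in> G \<Longrightarrow> p f x = 0" for x
      using that True by (intro insert.prems(3)) blast
    then show ?thesis by (rule insert.IH[OF insert.prems(1,2)])
  next
    case False
    then obtain z where z: "\<And>f. f \<in> G \<Longrightarrow> p f z = 0" "p g z \<noteq> 0" by blast
    define a where "a = \<phi> z / p g z"
    define \<psi> where "\<psi> = (\<lambda>x. \<phi> x - a * p g x)"
    have "\<exists>f. \<forall>x. \<psi> x = p f x"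
    proof (rule insert.IH)
      show "\<psi> (x + y) = \<psi> x + \<psi> y" for x y
        by (simp add: \<psi>_def insert.prems add_right algebra_simps)
      show "\<psi> (sE c x) = cnj c * \<psi> x" for c x
        by (simp add: \<psi>_def insert.prems scale_right algebra_simps)
      fix x assume x: "\<And>f. f \<in> G \<Longrightarrow> p f x = 0"
      define c where "c = - cnj (p g x / p g z)"
      have c: "cnj c = - (p g x / p g z)" by (simp add: c_def)
      have "p f (x + sE c z) = 0" if "f \<in> insert g G" for f
        using that x z by (auto simp: add_right scale_right c simp del: complex_cnj_divide)
      then have "\<phi> (x + sE c z) = 0" by (rule insert.prems(3))
      then have "\<phi> x = p g x / p g z * \<phi> z"
        by (simp add: insert.prems(1,2) c)
      then show "\<psi> x = 0" by (simp add: \<psi>_def a_def)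
    qed
    then obtain f where f: "\<And>x. \<psi> x = p f x" by blast
    have "\<phi> x = p (f + sF a g) x" for x
      using f[of x] by (simp add: add_left scale_left \<psi>_def algebra_simps)
    then show ?thesis by blast
  qed
qed

lemma sigma_EF_nhd_0:
  assumes "openin (sigma_EF p) U" "0 \<in> U"
  shows "\<exists>G e. finite G \<and> e > 0 \<and> (\<forall>x. (\<forall>f\<in>G. cmod (p f x) < e) \<longrightarrow> x \<in> U)"
proof -
  have "generate_topology_on {\<phi> -` U |\<phi> U. \<phi> \<in> range (\<lambda>f. \<lambda>x. p f x) \<and> open U} U"
    using assms(1) by (simp add: sigma_EF_def initial_topology_def openin_topology_generated_by_iff)
  then show ?thesis
    using assms(2)
  proof induction
    case Empty
    then show ?case by simp
  next
    case (Int a b)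
    then obtain G e H d where *: "finite G" "e > 0" "\<And>x. (\<forall>f\<in>G. cmod (p f x) < e) \<Longrightarrow> x \<in> a"
      "finite H" "d > 0" "\<And>x. (\<forall>f\<in>H. cmod (p f x) < d) \<Longrightarrow> x \<in> b" by blast
    then show ?case
      by (intro exI[of _ "G \<union> H"] exI[of _ "min e d"]) auto
  next
    case (UN K)
    then show ?case by (metis UnionE UnionI)
  next
    case (Basis s)
    then obtain f V where s: "s = (\<lambda>x. p f x) -` V" "open V" by blast
    with Basis.prems have "0 \<in> V" by (simp add: zero_right)
    with s obtain e where "e > 0" "\<And>z. cmod z < e \<Longrightarrow> z \<in> V"
      by (metis open_dist dist_0_norm dist_commute)
    with s show ?case by (intro exI[of _ "{f}"] exI[of _ e]) auto
  qed
qed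

lemma weakly_continuous_representation:
  assumes add: "\<And>x y. \<phi> (x + y) = \<phi> x + \<phi> y" and scale: "\<And>c x. \<phi> (sE c x) = cnj c * \<phi> x"
    and cont: "continuous_map (sigma_EF p) euclidean \<phi>"
  shows "\<exists>f. \<forall>x. \<phi> x = p f x"
proof -
  have top: "topspace (sigma_EF p) = UNIV"
    by (simp add: sigma_EF_def topspace_initial_topology)
  have "openin (sigma_EF p) {x. \<phi> x \<in> ball 0 1}"
    using cont openin_continuous_map_preimage[OF cont, of "ball 0 1"] top by simp
  moreover have "\<phi> 0 = 0" using add[of 0 0] by simp
  ultimately obtain G e where G: "finite G" "e > 0"
    "\<And>x. (\<forall>f\<in>G. cmod (p f x) < e) \<Longrightarrow> cmod (\<phi> x) < 1"
    using sigma_EF_nhd_0[of "{x. \<phi> x \<in> ball 0 1}"] by auto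
  show ?thesis
  proof (rule kernel_representation[OF G(1) add scale])
    fix x assume x: "\<And>f. f \<in> G \<Longrightarrow> p f x = 0"
    show "\<phi> x = 0"
    proof (rule ccontr)
      assume nz: "\<phi> x \<noteq> 0"
      have "cmod (\<phi> (sE (cnj (1 / \<phi> x)) x)) < 1"
        using x G(2) by (intro G(3)) (simp add: scale_right)
      with nz show False by (simp add: scale)
    qed
  qed
qed

lemma adjoint_ex1:
  assumes "T \<in> weakly_continuous_ops sE sF p"
  shows "\<exists>!R. R \<in> weakly_continuous_ops sE sF p \<and> (\<forall>x y. p (T x) y = cnj (p (R y) x))"
proof -
  from assms interpret T: Vector_Spaces.linear sE sF T by (simp add: weakly_continuous_ops_def)
  have T_cont: "continuous_map (sigma_EF p) euclidean (\<lambda>x. p (T x) y)" for y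
    using assms unfolding weakly_continuous_ops_def sigma_FE_def
    by (auto simp: continuous_map_initial_iff)
  have cnj_cont: "continuous_map X euclidean (\<lambda>x. cnj (g x))"
    if "continuous_map X euclidean g" for g :: "'x \<Rightarrow> complex" and X
    using continuous_map_compose[OF that, of euclidean cnj]
    by (simp add: o_def continuous_on_cnj)
  have "\<exists>f. \<forall>x. cnj (p (T x) y) = p f x" for y
    by (rule weakly_continuous_representation)
      (simp_all add: T.add T.scale add_left scale_left cnj_cont T_cont)
  then obtain R where R: "\<And>x y. cnj (p (T x) y) = p (R y) x" by metis
  have "Vector_Spaces.linear sE sF R"
  proof (unfold_locales)
    show "R (x + y) = R x + R y" for x y
      by (rule left_eqI) (simp add: add_left add_right flip: R)
    show "R (sE c x) = sF c (R x)" for c x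
      by (rule left_eqI) (simp add: scale_left scale_right flip: R)
  qed
  moreover have "continuous_map (sigma_EF p) (sigma_FE p) R"
  proof -
    have "continuous_map (sigma_EF p) euclidean (\<lambda>y. p (R y) x)" for x
      unfolding R[symmetric] sigma_EF_def by (intro cnj_cont continuous_map_initial) simp
    then show ?thesis
      unfolding sigma_FE_def by (auto simp: continuous_map_initial_iff)
  qed
  moreover have "\<forall>x y. p (T x) y = cnj (p (R y) x)"
    by (simp flip: R)
  moreover have "R' = R" if "\<forall>x y. p (T x) y = cnj (p (R' y) x)" for R'
  proof
    fix y
    show "R' y = R y" by (rule left_eqI) (use that in \<open>simp flip: R\<close>)
  qed
  ultimately show ?thesis unfolding weakly_continuous_ops_def by blast
qed

lemma self_adjoint_iff:
  "self_adjoint sE sF p T \<longleftrightarrow> T \<in> weakly_continuous_ops sE sF p \<and> symmetric_on p UNIV T"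
proof (cases "T \<in> weakly_continuous_ops sE sF p")
  case True
  have "adjoint_op sE sF p T = T \<longleftrightarrow> (\<forall>x y. p (T x) y = cnj (p (T y) x))"
  proof
    assume eq: "adjoint_op sE sF p T = T"
    show "\<forall>x y. p (T x) y = cnj (p (T y) x)"
      using theI'[OF adjoint_ex1[OF True]] unfolding adjoint_op_def[symmetric] eq by (rule conjunct2)
  next
    assume "\<forall>x y. p (T x) y = cnj (p (T y) x)"
    with True show "adjoint_op sE sF p T = T"
      unfolding adjoint_op_def by (intro the1_equality[OF adjoint_ex1[OF True]] conjI)
  qed
  with True show ?thesis by (simp add: self_adjoint_def symmetric_on_def)
qed (simp add: self_adjoint_def)

end

end

theory Submission
  imports Defs
begin

text \<open>
  Write \<open>\<alpha>\<close> for the bound of \<open>S0\<close> and \<open>q x = p (A x) x\<close>. Restriction to \<open>D\<close> can only decrease a bound,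
  so an extension of \<open>S0\<close> has bound \<open>\<alpha>\<close> as soon as \<open>\<alpha>\<close> is an admissible constant for it
  (\<open>A_bound_extension_eq_iff\<close>), and by polarisation this means that its quadratic form lies between
  \<open>-\<alpha> q\<close> and \<open>\<alpha> q\<close> (\<open>A_bound_const_iff_form_bound\<close>). Adding \<open>\<alpha> A\<close> turns the problem into a question about
  positive extensions \<open>B\<close> of \<open>B0 = S0 + \<alpha> A\<close> with \<open>B \<le> 2 \<alpha> A\<close>.

  The form of any positive extension \<open>B\<close> dominates
  \<open>Q x = sup {2 Re (p (B0 d) x) - p (B0 d) d | d \<in> D}\<close>, because \<open>p (B (x - d)) (x - d) \<ge> 0\<close>. The supremum
  \<open>Q\<close> is itself the form of an extension, the Krein-von Neumann extension: in the completion of \<open>D\<close> under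
  the form of \<open>B0\<close> it is the squared norm of the vector that represents \<open>x\<close>. No completion is formed
  here. One picks \<open>d n\<close> in \<open>D\<close> that nearly attain the supremum; then \<open>B0 (d n)\<close> is Cauchy in the
  weak-star topology, and its limit, which exists by sequential completeness, is \<open>B x\<close>
  (\<open>krein_von_neumann_extension\<close>).

  That the supremum is finite, and in fact at most \<open>2 \<alpha> q x\<close>, follows from
  \<open>2 Re (p (S0 d) z) \<le> \<alpha> (q z + q d)\<close> by substituting \<open>z = 2 x - d\<close>. So there is a least
  extension \<open>Sm\<close> of \<open>S0\<close> with the given bound (\<open>least_extension_with_bound\<close>), and applying this to \<open>-S0\<close>
  gives the greatest one, \<open>SM\<close>. Conversely, an operator \<open>S\<close> between \<open>Sm\<close> and \<open>SM\<close> satisfies the bound, and on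
  \<open>D\<close> the positive form of \<open>S - Sm\<close> vanishes, so that \<open>S = Sm = S0\<close> there.
\<close>

section \<open>Scalar inequalities\<close>

text \<open>The discriminant argument behind every Cauchy-Schwarz inequality below: choose the phase of
  \<open>c\<close> so that \<open>c * g\<close> is real and optimise over its modulus.\<close>

lemma cmod_square_le_of_linear_le_quadratic:
  assumes K: "0 \<le> K" and le: "\<And>c. 2 * Re (c * g) \<le> (cmod c)\<^sup>2 * K + M"
  shows "(cmod g)\<^sup>2 \<le> K * M"
proof -
  have *: "2 * t * (cmod g)\<^sup>2 \<le> t\<^sup>2 * (cmod g)\<^sup>2 * K + M" for t :: real
  proof -
    have "Re (of_real t * cnj g * g) = t * (cmod g)\<^sup>2"
      unfolding cmod_power2 by (simp add: power2_eq_square algebra_simps)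
    then show ?thesis
      using le[of "of_real t * cnj g"] by (simp add: norm_mult power_mult_distrib)
  qed
  have M: "0 \<le> M" using *[of 0] by simp
  show ?thesis
  proof (cases "K = 0")
    case True
    have "(cmod g)\<^sup>2 = 0"
    proof (rule ccontr)
      assume "(cmod g)\<^sup>2 \<noteq> 0"
      then show False using *[of "(M + 1) / (cmod g)\<^sup>2"] True M by simp
    qed
    with True show ?thesis by simp
  next
    case False
    with K have "0 < K" by simp
    with *[of "1 / K"] show ?thesis by (simp add: field_simps power2_eq_square)
  qed
qed

lemma squeeze_to_zero:
  fixes f g :: "nat \<Rightarrow> real"
  assumes "\<And>n. 0 \<le> f n" "\<And>n. f n \<le> g n" "g \<longlonglongrightarrow> 0"
  shows "f \<longlonglongrightarrow> 0"
  by (rule tendsto_sandwich[OF _ _ tendsto_const assms(3)]) (simp_all add: assms(1,2))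

lemma Re_cnj_mult_self: "Re (cnj c * c * z) = (cmod c)\<^sup>2 * Re z"
  unfolding cmod_power2 by (simp add: power2_eq_square algebra_simps)

section \<open>Symmetric operators and their quadratic forms\<close>

lemma symmetricD:
  "symmetric_on p U T \<Longrightarrow> x \<in> U \<Longrightarrow> y \<in> U \<Longrightarrow> p (T x) y = cnj (p (T y) x)"
  unfolding symmetric_on_def by blast

lemma symmetricI:
  "(\<And>x y. x \<in> U \<Longrightarrow> y \<in> U \<Longrightarrow> p (T x) y = cnj (p (T y) x)) \<Longrightarrow> symmetric_on p U T"
  unfolding symmetric_on_def by blast

lemma symmetric_on_subset: "symmetric_on p U T \<Longrightarrow> V \<subseteq> U \<Longrightarrow> symmetric_on p V T"
  unfolding symmetric_on_def by blast

context anti_dual_pair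
begin

lemma symmetric_add:
  assumes "symmetric_on p U S" "symmetric_on p U T"
  shows "symmetric_on p U (\<lambda>x. S x + T x)"
proof (rule symmetricI)
  fix x y assume "x \<in> U" "y \<in> U"
  with assms[THEN symmetricD, of x y] show "p (S x + T x) y = cnj (p (S y + T y) x)"
    by (simp add: add_left)
qed

lemma symmetric_scale:
  assumes "symmetric_on p U S"
  shows "symmetric_on p U (\<lambda>x. sF (of_real r) (S x))"
proof (rule symmetricI)
  fix x y assume "x \<in> U" "y \<in> U"
  with symmetricD[OF assms, of x y]
  show "p (sF (of_real r) (S x)) y = cnj (p (sF (of_real r) (S y)) x)"
    by (simp add: scale_left)
qed

lemma symmetric_uminus: "symmetric_on p U S \<Longrightarrow> symmetric_on p U (\<lambda>x. - S x)"
  using symmetric_scale[of U S "- 1"] by simp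

lemma symmetric_diff:
  "symmetric_on p U S \<Longrightarrow> symmetric_on p U T \<Longrightarrow> symmetric_on p U (\<lambda>x. S x - T x)"
  using symmetric_add[OF _ symmetric_uminus, of U S T] by simp

lemma diff_right: "p f (x - y) = p f x - p f y"
  using add_right[of f "x - y" y] by simp

text \<open>The property of absorbing all late differences \<open>s m - s n\<close> passes from neighbourhoods of \<open>0\<close> to
  their finite intersections and to larger sets, so it suffices to check it on the subbasis, that
  is, for one evaluation \<open>\<lambda>f. p f y\<close> at a time.\<close>

lemma tvs_Cauchy_sigma_FE:
  assumes "\<And>y \<epsilon>. \<epsilon> > 0 \<Longrightarrow> \<exists>N. \<forall>m\<ge>N. \<forall>n\<ge>N. cmod (p (s m - s n) y) < \<epsilon>"
  shows "tvs_Cauchy (sigma_FE p) s"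
  unfolding tvs_Cauchy_def
proof (intro allI impI, elim conjE)
  fix U assume "openin (sigma_FE p) U" and 0: "0 \<in> U"
  then have "generate_topology_on {\<phi> -` U |\<phi> U. \<phi> \<in> range (\<lambda>x. \<lambda>f. p f x) \<and> open U} U"
    by (simp add: sigma_FE_def initial_topology_def openin_topology_generated_by_iff)
  then show "\<exists>N. \<forall>m\<ge>N. \<forall>n\<ge>N. s m - s n \<in> U"
    using 0
  proof induction
    case Empty
    then show ?case by simp
  next
    case (Int a b)
    then obtain N M where "\<forall>m\<ge>N. \<forall>n\<ge>N. s m - s n \<in> a" "\<forall>m\<ge>M. \<forall>n\<ge>M. s m - s n \<in> b"
      by blast
    then show ?case by (intro exI[of _ "max N M"]) auto
  next
    case (UN K)
    then show ?case by (metis UnionE UnionI)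
  next
    case (Basis u)
    then obtain y V where u: "u = (\<lambda>f. p f y) -` V" "open V" by blast
    with Basis.prems have "0 \<in> V" by (simp add: zero_left)
    with u obtain \<epsilon> where "\<epsilon> > 0" "\<And>z. cmod z < \<epsilon> \<Longrightarrow> z \<in> V"
      by (metis open_dist dist_0_norm dist_commute)
    with u assms[of \<epsilon> y] show ?case by auto
  qed
qed

lemma limitin_sigma_FE_pointwise:
  assumes "limitin (sigma_FE p) s l sequentially"
  shows "(\<lambda>n. p (s n) y) \<longlonglongrightarrow> p l y"
proof -
  have "continuous_map (sigma_FE p) euclidean (\<lambda>f. p f y)"
    unfolding sigma_FE_def by (intro continuous_map_initial) auto
  from continuous_map_limit[OF this assms] show ?thesis by (simp add: o_def)
qed

text \<open>The right-hand side of \<open>p (T x) y = cnj (p (T y) x)\<close> is linear and weakly continuous in \<open>x\<close>,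
  whatever \<open>T\<close> is. As the pair is separating, \<open>T\<close> inherits both properties, here linearity and
  in the next lemma continuity.\<close>

lemma symmetric_imp_linear:
  assumes "symmetric_on p UNIV T"
  shows "Vector_Spaces.linear sE sF T"
proof -
  have T: "p (T x) y = cnj (p (T y) x)" for x y
    using symmetricD[OF assms] by blast
  show ?thesis
  proof unfold_locales
    show "T (x + y) = T x + T y" for x y
    proof (rule left_eqI)
      fix z
      have "p (T (x + y)) z = cnj (p (T z) x) + cnj (p (T z) y)"
        by (subst T) (simp add: add_right)
      also have "\<dots> = p (T x + T y) z" by (simp add: add_left flip: T)
      finally show "p (T (x + y)) z = p (T x + T y) z" .
    qed
    show "T (sE c x) = sF c (T x)" for c x
    proof (rule left_eqI)
      fix y
      have "p (T (sE c x)) y = c * cnj (p (T y) x)" by (subst T) (simp add: scale_right)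
      also have "\<dots> = p (sF c (T x)) y" by (simp add: scale_left flip: T)
      finally show "p (T (sE c x)) y = p (sF c (T x)) y" .
    qed
  qed
qed

lemma symmetric_imp_self_adjoint:
  assumes "symmetric_on p UNIV T"
  shows "self_adjoint sE sF p T"
proof -
  have T: "p (T x) y = cnj (p (T y) x)" for x y
    using symmetricD[OF assms] by blast
  have "continuous_map (sigma_EF p) euclidean (\<lambda>x. p (T x) y)" for y
  proof -
    have "continuous_map (sigma_EF p) euclidean (\<lambda>x. p (T y) x)"
      unfolding sigma_EF_def by (intro continuous_map_initial) auto
    then have "continuous_map (sigma_EF p) euclidean (cnj \<circ> (\<lambda>x. p (T y) x))"
      by (rule continuous_map_compose) (simp add: continuous_on_cnj)
    then show ?thesis by (subst T) (simp add: o_def)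
  qed
  then have "continuous_map (sigma_EF p) (sigma_FE p) T"
    unfolding sigma_FE_def by (auto simp: continuous_map_initial_iff)
  with assms symmetric_imp_linear[OF assms] show ?thesis
    by (simp add: self_adjoint_iff weakly_continuous_ops_def)
qed

lemma self_adjoint_iff_symmetric: "self_adjoint sE sF p T \<longleftrightarrow> symmetric_on p UNIV T"
  using self_adjoint_iff symmetric_imp_self_adjoint by blast

text \<open>Over the complex numbers a form that is real on the diagonal is hermitian: compare
  its imaginary parts at \<open>x + y\<close> and at \<open>\<i> x + y\<close>.\<close>

lemma positive_imp_symmetric:
  assumes "Vector_Spaces.linear sE sF T" and "positive_op p T"
  shows "symmetric_on p UNIV T"
proof -
  interpret T: Vector_Spaces.linear sE sF T by fact
  have im: "Im (p (T x) x) = 0" for x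
    using assms(2) by (simp add: positive_op_def less_eq_complex_def)
  show ?thesis
    unfolding symmetric_on_def
  proof (intro ballI)
    fix x y
    have "Im (p (T x) y + p (T y) x) = 0"
      using im[of "x + y"] im[of x] im[of y]
      by (simp add: T.add add_left add_right)
    moreover have "Re (p (T x) y) = Re (p (T y) x)"
      using im[of "sE \<i> x + y"] im[of x] im[of y]
      by (simp add: T.add T.scale add_left add_right scale_left scale_right)
    ultimately show "p (T x) y = cnj (p (T y) x)"
      by (simp add: complex_eq_iff)
  qed
qed

lemma Re_form_scale_right: "Re (p f (sE (cnj c) y)) = Re (c * p f y)"
  by (simp add: scale_right)

lemma symmetric_form_add:
  assumes "symmetric_on p UNIV T"
  shows "Re (p (T (x + y)) (x + y)) = Re (p (T x) x) + 2 * Re (p (T x) y) + Re (p (T y) y)"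
    and "Re (p (T (x - y)) (x - y)) = Re (p (T x) x) - 2 * Re (p (T x) y) + Re (p (T y) y)"
proof -
  interpret T: Vector_Spaces.linear sE sF T by (rule symmetric_imp_linear) fact
  have "p (T y) x = cnj (p (T x) y)" by (rule symmetricD[OF assms]) auto
  then show "Re (p (T (x + y)) (x + y)) = Re (p (T x) x) + 2 * Re (p (T x) y) + Re (p (T y) y)"
    and "Re (p (T (x - y)) (x - y)) = Re (p (T x) x) - 2 * Re (p (T x) y) + Re (p (T y) y)"
    by (simp_all add: T.add T.diff add_left add_right diff_left diff_right)
qed

lemma Re_form_scale_scale: "Re (p (sF c f) (sE c x)) = (cmod c)\<^sup>2 * Re (p f x)"
  using Re_cnj_mult_self[of c "p f x"]
  by (simp only: scale_left scale_right mult.assoc mult.left_commute)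

lemma symmetric_form_scale:
  assumes "symmetric_on p UNIV T"
  shows "Re (p (T (sE c x)) (sE c x)) = (cmod c)\<^sup>2 * Re (p (T x) x)"
proof -
  interpret T: Vector_Spaces.linear sE sF T by (rule symmetric_imp_linear) fact
  show ?thesis by (simp add: T.scale Re_form_scale_scale)
qed

lemma symmetric_positive_iff:
  assumes "symmetric_on p UNIV T"
  shows "positive_op p T \<longleftrightarrow> (\<forall>x. 0 \<le> Re (p (T x) x))"
proof -
  have "Im (p (T x) x) = 0" for x
    using symmetricD[OF assms, of x x] by (simp add: complex_eq_iff)
  then show ?thesis by (simp add: positive_op_def less_eq_complex_def)
qed

lemma symmetric_op_le_iff:
  assumes "symmetric_on p UNIV S" "symmetric_on p UNIV T"
  shows "op_le p S T \<longleftrightarrow> (\<forall>x. Re (p (S x) x) \<le> Re (p (T x) x))"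
proof -
  have "symmetric_on p UNIV (\<lambda>x. T x - S x)" by (intro symmetric_diff assms)
  then show ?thesis by (simp add: op_le_def symmetric_positive_iff diff_left)
qed

text \<open>Cauchy-Schwarz for the positive form of \<open>S\<close>, in its degenerate case.\<close>

lemma form_null_imp_zero:
  assumes S: "symmetric_on p UNIV S" and pos: "\<And>y. 0 \<le> Re (p (S y) y)"
    and null: "Re (p (S x) x) = 0"
  shows "S x = 0"
proof (rule separating_F)
  fix y
  interpret S: Vector_Spaces.linear sE sF S by (rule symmetric_imp_linear) fact
  have "2 * Re (c * p (S x) y) \<le> (cmod c)\<^sup>2 * Re (p (S y) y) + 0" for c
    using pos[of "x - sE (cnj c) y"]
    by (simp add: symmetric_form_add[OF S] symmetric_form_scale[OF S] null
        Re_form_scale_right[of "S x" c y])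
  from cmod_square_le_of_linear_le_quadratic[OF pos this] show "p (S x) y = 0" by simp
qed

text \<open>For symmetric operators the bound may be tested on the diagonal. The nontrivial direction is
  polarisation: \<open>4 Re (p (S x) y)\<close> is the difference of the forms at \<open>x + y\<close> and \<open>x - y\<close>, so the
  parallelogram law for \<open>q x = p (A x) x\<close> gives \<open>2 Re (p (S x) y) \<le> \<alpha> (q x + q y)\<close>, and optimising
  over the multiples of \<open>y\<close> replaces the sum by the product.\<close>

lemma A_bound_const_iff_form_bound:
  assumes S: "symmetric_on p UNIV S" and A: "symmetric_on p UNIV A"
    and pos: "\<And>x. 0 \<le> Re (p (A x) x)" and \<alpha>: "0 \<le> \<alpha>"
  shows "A_bound_const p A UNIV S \<alpha> \<longleftrightarrow> (\<forall>x. \<bar>Re (p (S x) x)\<bar> \<le> \<alpha> * Re (p (A x) x))"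
proof
  assume bd: "A_bound_const p A UNIV S \<alpha>"
  show "\<forall>x. \<bar>Re (p (S x) x)\<bar> \<le> \<alpha> * Re (p (A x) x)"
  proof
    fix x
    have "(cmod (p (S x) x))\<^sup>2 \<le> (\<alpha> * Re (p (A x) x))\<^sup>2"
      using bd by (simp add: A_bound_const_def power2_eq_square mult_ac)
    then have "cmod (p (S x) x) \<le> \<alpha> * Re (p (A x) x)"
      by (rule power2_le_imp_le) (simp add: \<alpha> pos)
    then show "\<bar>Re (p (S x) x)\<bar> \<le> \<alpha> * Re (p (A x) x)"
      using abs_Re_le_cmod[of "p (S x) x"] by linarith
  qed
next
  assume le: "\<forall>x. \<bar>Re (p (S x) x)\<bar> \<le> \<alpha> * Re (p (A x) x)"
  have polar: "2 * Re (p (S x) y) \<le> \<alpha> * Re (p (A y) y) + \<alpha> * Re (p (A x) x)" for x y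
    using abs_le_D1[OF le[rule_format, of "x + y"]] abs_le_D2[OF le[rule_format, of "x - y"]]
    unfolding symmetric_form_add[OF S] symmetric_form_add[OF A] by (simp add: algebra_simps)
  have "(cmod (p (S x) y))\<^sup>2 \<le> (\<alpha> * Re (p (A y) y)) * (\<alpha> * Re (p (A x) x))" for x y
  proof (rule cmod_square_le_of_linear_le_quadratic)
    show "0 \<le> \<alpha> * Re (p (A y) y)" by (simp add: \<alpha> pos)
    show "2 * Re (c * p (S x) y) \<le> (cmod c)\<^sup>2 * (\<alpha> * Re (p (A y) y)) + \<alpha> * Re (p (A x) x)" for c
      using polar[of x "sE (cnj c) y"]
      by (simp add: Re_form_scale_right[of "S x" c y] symmetric_form_scale[OF A] mult_ac)
  qed
  then show "A_bound_const p A UNIV S \<alpha>"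
    by (simp add: A_bound_const_def \<alpha> power2_eq_square mult_ac)
qed

end

section \<open>The Krein-von Neumann extension\<close>

text \<open>Up to rescaling \<open>d\<close>, the existence of the bounds \<open>M x\<close> means that every \<open>x\<close> defines a functional
  \<open>\<lambda>d. p (B0 d) x\<close> that is bounded for the seminorm given on \<open>D\<close> by the form of \<open>B0\<close>.\<close>

locale positive_form_bounded = anti_dual_pair sE sF p
  for sE :: "complex \<Rightarrow> 'e::ab_group_add \<Rightarrow> 'e"
    and sF :: "complex \<Rightarrow> 'f::ab_group_add \<Rightarrow> 'f"
    and p :: "'f \<Rightarrow> 'e \<Rightarrow> complex" +
  fixes D :: "'e set" and B0 :: "'e \<Rightarrow> 'f" and M :: "'e \<Rightarrow> real"
  assumes seq_complete: "weak_star_sequentially_complete p"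
    and subspace_D: "module.subspace sE D"
    and linear_B0: "linear_operator_on sE sF D B0"
    and sym_B0: "symmetric_on p D B0"
    and pos_B0: "\<And>d. d \<in> D \<Longrightarrow> 0 \<le> Re (p (B0 d) d)"
    and bounded_B0: "\<And>d x. d \<in> D \<Longrightarrow> 2 * Re (p (B0 d) x) - Re (p (B0 d) d) \<le> M x"
begin

lemma D_closed:
  "0 \<in> D" "d \<in> D \<Longrightarrow> e \<in> D \<Longrightarrow> d + e \<in> D" "d \<in> D \<Longrightarrow> sE c d \<in> D"
  "d \<in> D \<Longrightarrow> e \<in> D \<Longrightarrow> d - e \<in> D"
  using subspace_D E.subspace_0 E.subspace_add E.subspace_scale E.subspace_diff by blast+

lemma B0_add: "d \<in> D \<Longrightarrow> e \<in> D \<Longrightarrow> B0 (d + e) = B0 d + B0 e"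
  and B0_scale: "d \<in> D \<Longrightarrow> B0 (sE c d) = sF c (B0 d)"
  using linear_B0 by (auto simp: linear_operator_on_def)

lemma B0_diff: "d \<in> D \<Longrightarrow> e \<in> D \<Longrightarrow> B0 (d - e) = B0 d - B0 e"
  using B0_add[of "d - e" e] D_closed by simp

lemma B0_zero: "B0 0 = 0"
  using B0_diff[of 0 0] D_closed by simp

lemma B0_sym: "d \<in> D \<Longrightarrow> e \<in> D \<Longrightarrow> p (B0 d) e = cnj (p (B0 e) d)"
  by (rule symmetricD[OF sym_B0])

text \<open>If \<open>B\<close> is a symmetric extension of \<open>B0\<close>, with form \<open>b\<close>, then \<open>J x d = b x x - b (x - d) (x - d)\<close>. For
  positive \<open>B\<close>, maximising \<open>J x\<close> thus means finding the point of \<open>D\<close> nearest to \<open>x\<close>; but \<open>J\<close>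
  is expressed by \<open>B0\<close> alone. The maximal value \<open>Q x\<close> is the squared seminorm of the projection
  of \<open>x\<close>, so \<open>Q\<close> behaves as the square of a seminorm, and \<open>x\<close> is approximated by a sequence
  \<open>d\<close> in \<open>D\<close> when the projection of \<open>x - d n\<close> tends to \<open>0\<close>.\<close>

definition J :: "'e \<Rightarrow> 'e \<Rightarrow> real" where
  "J x d = 2 * Re (p (B0 d) x) - Re (p (B0 d) d)"

definition Q :: "'e \<Rightarrow> real" where
  "Q x = (SUP d\<in>D. J x d)"

lemma J_le_Q: "d \<in> D \<Longrightarrow> J x d \<le> Q x"
  unfolding Q_def
  by (rule cSUP_upper) (auto intro!: bdd_aboveI[of _ "M x"] simp: J_def bounded_B0)

lemma Q_least: "(\<And>d. d \<in> D \<Longrightarrow> J x d \<le> m) \<Longrightarrow> Q x \<le> m"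
  unfolding Q_def using D_closed(1) by (intro cSUP_least) auto

lemma Q_nonneg: "0 \<le> Q x"
  using J_le_Q[OF D_closed(1), of x] by (simp add: J_def B0_zero zero_left)

lemma J_scale: "d \<in> D \<Longrightarrow> J (sE c x) (sE c d) = (cmod c)\<^sup>2 * J x d"
  by (simp add: J_def B0_scale Re_form_scale_scale right_diff_distrib mult.left_commute[of 2])

lemma J_translate: "d \<in> D \<Longrightarrow> e \<in> D \<Longrightarrow> J x (d + e) = J x d + J (x - d) e"
  using B0_sym[of d e]
  by (simp add: J_def B0_add add_left add_right diff_right)

lemma Q_scale_le: "Q (sE c x) \<le> (cmod c)\<^sup>2 * Q x"
proof (cases "c = 0")
  case True
  then show ?thesis
    using pos_B0 by (auto intro!: Q_least simp: J_def zero_right)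
next
  case False
  show ?thesis
  proof (rule Q_least)
    fix d assume d: "d \<in> D"
    have "J (sE c x) d = (cmod c)\<^sup>2 * J x (sE (1 / c) d)"
      using J_scale[of "sE (1 / c) d" c x] False d by (simp add: D_closed)
    also have "\<dots> \<le> (cmod c)\<^sup>2 * Q x"
      using J_le_Q d by (intro mult_left_mono) (auto simp: D_closed)
    finally show "J (sE c x) d \<le> (cmod c)\<^sup>2 * Q x" .
  qed
qed

lemma Q_uminus_le: "Q (- x) \<le> Q x"
  using Q_scale_le[of "-1" x] by simp

text \<open>The quadratic weak form of the triangle inequality comes from doubling the competitor:
  \<open>J (x + y) (2 e) = 2 J x e + 2 J y e\<close>.\<close>

lemma Q_add_le: "Q (x + y) \<le> 2 * Q x + 2 * Q y"
proof (rule Q_least)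
  fix d assume d: "d \<in> D"
  define e where "e = sE (1 / 2) d"
  have e: "e \<in> D" "d = sE 2 e" using d by (simp_all add: e_def D_closed)
  have "J (x + y) d = 2 * J x e + 2 * J y e"
    using e(1) by (simp add: J_def e(2) B0_scale scale_left scale_right add_right)
  also have "\<dots> \<le> 2 * Q x + 2 * Q y"
    using J_le_Q[OF e(1)] by (simp add: add_mono)
  finally show "J (x + y) d \<le> 2 * Q x + 2 * Q y" .
qed

text \<open>Completing the square, \<open>J x (d + e) = J x d + J (x - d) e\<close>: maximising \<open>J x\<close> from the
  starting point \<open>d\<close> is maximising \<open>J (x - d)\<close>. Hence \<open>d\<close> is a nearly optimal choice for \<open>x\<close>
  exactly when \<open>Q (x - d)\<close> is small.\<close>

lemma Q_residual:
  assumes d: "d \<in> D"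
  shows "Q (x - d) = Q x - J x d"
proof (rule antisym)
  show "Q (x - d) \<le> Q x - J x d"
  proof (rule Q_least)
    fix e assume "e \<in> D"
    with d J_translate[of d e x] J_le_Q[of "d + e" x] show "J (x - d) e \<le> Q x - J x d"
      by (simp add: D_closed)
  qed
  have "Q x \<le> J x d + Q (x - d)"
  proof (rule Q_least)
    fix e assume "e \<in> D"
    with d show "J x e \<le> J x d + Q (x - d)"
      using J_translate[of d "e - d" x] J_le_Q[of "e - d" "x - d"] by (simp add: D_closed)
  qed
  then show "Q x - J x d \<le> Q (x - d)" by simp
qed

lemma Q_ge_form: "d \<in> D \<Longrightarrow> Re (p (B0 d) d) \<le> Q d"
  using J_le_Q[of d d] by (simp add: J_def)

text \<open>Applied to differences \<open>d m - d n\<close>, this estimate turns closeness measured by \<open>Q\<close> into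
  weak-star closeness of the images under \<open>B0\<close>.\<close>

lemma form_Cauchy_Schwarz:
  assumes "d \<in> D"
  shows "(cmod (p (B0 d) y))\<^sup>2 \<le> Q d * Q y"
proof -
  have "(cmod (p (B0 d) y))\<^sup>2 \<le> Re (p (B0 d) d) * Q y"
  proof (rule cmod_square_le_of_linear_le_quadratic)
    show "0 \<le> Re (p (B0 d) d)" using assms pos_B0 by simp
    show "2 * Re (c * p (B0 d) y) \<le> (cmod c)\<^sup>2 * Re (p (B0 d) d) + Q y" for c
      using J_le_Q[of "sE c d" y] assms
      by (simp add: J_def B0_scale Re_form_scale_scale scale_left[of c "B0 d" y] D_closed)
  qed
  also have "\<dots> \<le> Q d * Q y"
    using assms Q_ge_form Q_nonneg by (intro mult_right_mono) auto
  finally show ?thesis .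
qed

definition approximates :: "(nat \<Rightarrow> 'e) \<Rightarrow> 'e \<Rightarrow> bool" where
  "approximates d x \<longleftrightarrow> (\<forall>n. d n \<in> D) \<and> (\<lambda>n. Q (x - d n)) \<longlonglongrightarrow> 0"

lemma ex_approximates: "\<exists>d. approximates d x"
proof -
  have "\<exists>d\<in>D. Q x - 1 / Suc n < J x d" for n :: nat
  proof (rule ccontr)
    assume "\<not> ?thesis"
    then have "Q x \<le> Q x - 1 / Suc n" by (intro Q_least) force
    then show False by (simp add: field_simps)
  qed
  then obtain d where d: "\<And>n. d n \<in> D" "\<And>n. Q x - 1 / Suc n < J x (d n)"
    by metis
  have "(\<lambda>n. Q (x - d n)) \<longlonglongrightarrow> 0"
  proof (rule tendsto_sandwich[OF _ _ tendsto_const LIMSEQ_Suc[OF lim_inverse_n']])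
    show "\<forall>\<^sub>F n in sequentially. Q (x - d n) \<le> 1 / real (Suc n)"
      using d Q_residual by (intro always_eventually) (smt (verit))
  qed (simp add: Q_nonneg)
  with d show ?thesis unfolding approximates_def by blast
qed

lemma approximates_const: "x \<in> D \<Longrightarrow> approximates (\<lambda>_. x) x"
  using Q_scale_le[of 0 0] Q_nonneg[of 0] by (simp add: approximates_def)

lemma approximates_add:
  assumes "approximates d x" "approximates e y"
  shows "approximates (\<lambda>n. d n + e n) (x + y)"
proof -
  have "(\<lambda>n. 2 * Q (x - d n) + 2 * Q (y - e n)) \<longlonglongrightarrow> 2 * 0 + 2 * 0"
    using assms unfolding approximates_def by (intro tendsto_intros) auto
  moreover have "Q (x + y - (d n + e n)) \<le> 2 * Q (x - d n) + 2 * Q (y - e n)" for n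
    using Q_add_le[of "x - d n" "y - e n"] by (simp add: algebra_simps)
  ultimately have "(\<lambda>n. Q (x + y - (d n + e n))) \<longlonglongrightarrow> 0"
    by - (rule squeeze_to_zero[where g =
            "\<lambda>n. 2 * Q (x - d n) + 2 * Q (y - e n)"],
          simp_all add: Q_nonneg)
  with assms show ?thesis by (simp add: approximates_def D_closed)
qed

lemma approximates_scale:
  assumes "approximates d x"
  shows "approximates (\<lambda>n. sE c (d n)) (sE c x)"
proof -
  have "(\<lambda>n. (cmod c)\<^sup>2 * Q (x - d n)) \<longlonglongrightarrow> (cmod c)\<^sup>2 * 0"
    using assms unfolding approximates_def by (intro tendsto_intros) auto
  moreover have "Q (sE c x - sE c (d n)) \<le> (cmod c)\<^sup>2 * Q (x - d n)" for n
    using Q_scale_le[of c "x - d n"] by (simp add: E.scale_right_diff_distrib)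
  ultimately have "(\<lambda>n. Q (sE c x - sE c (d n))) \<longlonglongrightarrow> 0"
    by - (rule squeeze_to_zero[where g =
            "\<lambda>n. (cmod c)\<^sup>2 * Q (x - d n)"],
          simp_all add: Q_nonneg)
  with assms show ?thesis by (simp add: approximates_def D_closed)
qed

lemma approximates_diff_form_le:
  assumes "d \<in> D" "e \<in> D"
  shows "(cmod (p (B0 d - B0 e) y))\<^sup>2 \<le> (2 * Q (x - d) + 2 * Q (x - e)) * Q y"
proof -
  have "(cmod (p (B0 d - B0 e) y))\<^sup>2 \<le> Q (d - e) * Q y"
    using form_Cauchy_Schwarz[of "d - e" y] assms by (simp add: B0_diff D_closed)
  also have "Q (d - e) \<le> 2 * Q (x - d) + 2 * Q (x - e)"
    using Q_add_le[of "- (x - d)" "x - e"] Q_uminus_le[of "x - d"] by simp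
  finally show ?thesis by (simp add: Q_nonneg mult_right_mono)
qed

lemma approximates_limit_unique:
  assumes "approximates d x" "approximates e x"
  shows "(\<lambda>n. p (B0 (d n)) y - p (B0 (e n)) y) \<longlonglongrightarrow> 0"
proof -
  have "(\<lambda>n. (2 * Q (x - d n) + 2 * Q (x - e n)) * Q y) \<longlonglongrightarrow> (2 * 0 + 2 * 0) * Q y"
    using assms unfolding approximates_def by (intro tendsto_intros) auto
  then have "(\<lambda>n. (cmod (p (B0 (d n)) y - p (B0 (e n)) y))\<^sup>2) \<longlonglongrightarrow> 0"
    using assms approximates_diff_form_le[of _ _ y x]
    by - (rule squeeze_to_zero[where g =
            "\<lambda>n. (2 * Q (x - d n) + 2 * Q (x - e n)) * Q y"],
          simp_all add: approximates_def diff_left)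
  then show ?thesis by (simp add: tendsto_norm_zero_iff)
qed

lemma approximates_limit_exists:
  assumes d: "approximates d x"
  shows "\<exists>f. \<forall>y. (\<lambda>n. p (B0 (d n)) y) \<longlonglongrightarrow> p f y"
proof -
  have "tvs_Cauchy (sigma_FE p) (\<lambda>n. B0 (d n))"
  proof (rule tvs_Cauchy_sigma_FE)
    fix y and \<epsilon> :: real assume \<epsilon>: "0 < \<epsilon>"
    define \<delta> where "\<delta> = \<epsilon>\<^sup>2 / (4 * (Q y + 1))"
    have y: "0 < Q y + 1" using Q_nonneg[of y] by simp
    then have \<delta>: "0 < \<delta>" "4 * (Q y + 1) * \<delta> = \<epsilon>\<^sup>2"
      using \<epsilon> by (simp_all add: \<delta>_def del: distrib_left_numeral)
    then obtain N where N: "\<And>n. n \<ge> N \<Longrightarrow> Q (x - d n) < \<delta>"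
      using d order_tendstoD(2)[of "\<lambda>n. Q (x - d n)" 0 sequentially \<delta>]
      unfolding approximates_def eventually_sequentially by blast
    have "cmod (p (B0 (d m) - B0 (d n)) y) < \<epsilon>" if "m \<ge> N" "n \<ge> N" for m n
    proof -
      have "(cmod (p (B0 (d m) - B0 (d n)) y))\<^sup>2 \<le> (2 * Q (x - d m) + 2 * Q (x - d n)) * Q y"
        using d by (intro approximates_diff_form_le) (simp_all add: approximates_def)
      also have "\<dots> \<le> 4 * \<delta> * Q y"
        using N[OF that(1)] N[OF that(2)] Q_nonneg by (intro mult_right_mono) auto
      also have "\<dots> < 4 * \<delta> * (Q y + 1)" using \<delta>(1) by simp
      also have "\<dots> = \<epsilon>\<^sup>2" using \<delta>(2) by (simp add: algebra_simps)
      finally show ?thesis using \<epsilon> by (simp add: power2_less_imp_less)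
    qed
    then show "\<exists>N. \<forall>m\<ge>N. \<forall>n\<ge>N. cmod (p (B0 (d m) - B0 (d n)) y) < \<epsilon>" by blast
  qed
  then obtain f where "limitin (sigma_FE p) (\<lambda>n. B0 (d n)) f sequentially"
    using seq_complete unfolding weak_star_sequentially_complete_def sequentially_complete_def
    by blast
  then show ?thesis using limitin_sigma_FE_pointwise by blast
qed

text \<open>The value \<open>B x\<close> is the weak-star limit of \<open>B0 (d n)\<close> for any sequence \<open>d\<close> that approximates \<open>x\<close>;
  independence of the sequence yields linearity and, with constant sequences, the extension
  property. Once the form of \<open>B\<close> is known to be \<open>Q\<close>, symmetry is automatic, since \<open>Q\<close> is
  real. That \<open>B\<close> is the least positive extension is contained in the formula for its form.\<close>

theorem krein_von_neumann_extension:
  obtains B where "symmetric_on p UNIV B" "extends_op B D B0" "\<And>x. Re (p (B x) x) = Q x"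
proof -
  have "\<exists>f. \<forall>d. approximates d x \<longrightarrow> (\<forall>y. (\<lambda>n. p (B0 (d n)) y) \<longlonglongrightarrow> p f y)" for x
  proof -
    obtain e where e: "approximates e x" using ex_approximates by blast
    then obtain f where f: "\<And>y. (\<lambda>n. p (B0 (e n)) y) \<longlonglongrightarrow> p f y"
      using approximates_limit_exists by blast
    have "(\<lambda>n. p (B0 (d n)) y) \<longlonglongrightarrow> p f y" if "approximates d x" for d y
      using tendsto_add[OF approximates_limit_unique[OF that e, of y] f[of y]] by simp
    then show ?thesis by blast
  qed
  then obtain B where B: "\<And>x d y. approximates d x \<Longrightarrow> (\<lambda>n. p (B0 (d n)) y) \<longlonglongrightarrow> p (B x) y"
    by metis
  have D: "d n \<in> D" if "approximates d x" for d x n using that by (simp add: approximates_def)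
  have linear: "Vector_Spaces.linear sE sF B"
  proof unfold_locales
    fix x y
    obtain d e where d: "approximates d x" and e: "approximates e y"
      using ex_approximates by metis
    show "B (x + y) = B x + B y"
    proof (rule left_eqI)
      fix z
      have "(\<lambda>n. p (B0 (d n)) z + p (B0 (e n)) z) \<longlonglongrightarrow> p (B (x + y)) z"
        using B[OF approximates_add[OF d e], of z] D[OF d] D[OF e] by (simp add: B0_add add_left)
      moreover have "(\<lambda>n. p (B0 (d n)) z + p (B0 (e n)) z) \<longlonglongrightarrow> p (B x + B y) z"
        unfolding add_left by (intro tendsto_add B d e)
      ultimately show "p (B (x + y)) z = p (B x + B y) z" by (rule LIMSEQ_unique)
    qed
  next
    fix c x
    obtain d where d: "approximates d x" using ex_approximates by metis
    show "B (sE c x) = sF c (B x)"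
    proof (rule left_eqI)
      fix z
      have "(\<lambda>n. c * p (B0 (d n)) z) \<longlonglongrightarrow> p (B (sE c x)) z"
        using B[OF approximates_scale[OF d], of c z] D[OF d] by (simp add: B0_scale scale_left)
      moreover have "(\<lambda>n. c * p (B0 (d n)) z) \<longlonglongrightarrow> p (sF c (B x)) z"
        unfolding scale_left by (intro tendsto_mult tendsto_const B d)
      ultimately show "p (B (sE c x)) z = p (sF c (B x)) z" by (rule LIMSEQ_unique)
    qed
  qed
  have ext: "B x = B0 x" if "x \<in> D" for x
  proof (rule left_eqI)
    fix y
    show "p (B x) y = p (B0 x) y"
      using B[OF approximates_const[OF that], of y] by (simp add: LIMSEQ_const_iff)
  qed
  \<comment> \<open>Both \<open>p (B0 (d n)) x\<close> and \<open>p (B0 (d n)) (d n)\<close> tend to \<open>p (B x) x\<close>, hence so does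
    \<open>J x (d n)\<close>, whose limit is also \<open>Q x\<close>.\<close>
  have diag: "p (B x) x = of_real (Q x)" for x
  proof -
    obtain d where d: "approximates d x" using ex_approximates by metis
    note dD = D[OF d]
    have L: "(\<lambda>n. p (B0 (d n)) x) \<longlonglongrightarrow> p (B x) x" by (rule B[OF d])
    have lim: "(\<lambda>n. (2 * Q x + 2 * Q (x - d n)) * Q (x - d n)) \<longlonglongrightarrow> (2 * Q x + 2 * 0) * 0"
      using d unfolding approximates_def by (intro tendsto_intros) auto
    have "(cmod (p (B0 (d n)) (x - d n)))\<^sup>2 \<le> (2 * Q x + 2 * Q (x - d n)) * Q (x - d n)" for n
    proof -
      have "Q (d n) \<le> 2 * Q x + 2 * Q (x - d n)"
        using Q_add_le[of x "- (x - d n)"] Q_uminus_le[of "x - d n"] by simp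
      then show ?thesis
        using form_Cauchy_Schwarz[OF dD, of n "x - d n"] Q_nonneg[of "x - d n"]
        by (meson mult_right_mono order_trans)
    qed
    then have "(\<lambda>n. (cmod (p (B0 (d n)) (x - d n)))\<^sup>2) \<longlonglongrightarrow> 0"
      using lim by - (rule squeeze_to_zero[where g =
              "\<lambda>n. (2 * Q x + 2 * Q (x - d n)) * Q (x - d n)"],
            simp_all)
    then have "(\<lambda>n. p (B0 (d n)) (x - d n)) \<longlonglongrightarrow> 0" by (simp add: tendsto_norm_zero_iff)
    from tendsto_diff[OF L this]
    have Ld: "(\<lambda>n. p (B0 (d n)) (d n)) \<longlonglongrightarrow> p (B x) x" by (simp add: diff_right)
    have "Im (p (B0 (d n)) (d n)) = 0" for n
      using B0_sym[OF dD dD, of n n] by (simp add: complex_eq_iff)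
    with tendsto_Im[OF Ld] have im: "Im (p (B x) x) = 0" by (simp add: LIMSEQ_const_iff)
    have "(\<lambda>n. J x (d n)) \<longlonglongrightarrow> 2 * Re (p (B x) x) - Re (p (B x) x)"
      unfolding J_def by (intro tendsto_intros L Ld)
    moreover have "(\<lambda>n. J x (d n)) \<longlonglongrightarrow> Q x"
    proof -
      have "(\<lambda>n. Q x - Q (x - d n)) \<longlonglongrightarrow> Q x - 0"
        using d unfolding approximates_def by (intro tendsto_intros) auto
      then show ?thesis by (simp add: Q_residual dD)
    qed
    ultimately have "Re (p (B x) x) = Q x" using LIMSEQ_unique by force
    with im show ?thesis by (simp add: complex_eq_iff)
  qed
  show ?thesis
  proof
    show "symmetric_on p UNIV B"
      using linear by (rule positive_imp_symmetric)
        (simp add: positive_op_def diag less_eq_complex_def Q_nonneg)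
  qed (simp_all add: extends_op_def ext diag)
qed

end

section \<open>Extremal extensions that preserve the bound\<close>

context anti_dual_pair
begin

text \<open>The Krein-von Neumann extension of \<open>S0 + \<alpha> A\<close>, shifted back by \<open>\<alpha> A\<close>. Its form is at least
  \<open>-\<alpha> q\<close> by positivity and at most \<open>\<alpha> q\<close> because \<open>Q \<le> 2 \<alpha> q\<close>, where \<open>q x = p (A x) x\<close>.\<close>

lemma least_extension_with_bound:
  assumes complete: "weak_star_sequentially_complete p"
    and D: "module.subspace sE D"
    and lin: "linear_operator_on sE sF D S0"
    and sym: "symmetric_on p D S0"
    and A: "symmetric_on p UNIV A" and pos: "\<And>x. 0 \<le> Re (p (A x) x)"
    and bd: "A_bound_const p A D S0 \<alpha>"
  shows "\<exists>S. symmetric_on p UNIV S \<and> extends_op S D S0 \<and> A_bound_const p A UNIV S \<alpha> \<and>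
    (\<forall>T. symmetric_on p UNIV T \<and> extends_op T D S0 \<and> A_bound_const p A UNIV T \<alpha> \<longrightarrow>
      (\<forall>x. Re (p (S x) x) \<le> Re (p (T x) x)))"
proof -
  interpret A: Vector_Spaces.linear sE sF A by (rule symmetric_imp_linear) fact
  have \<alpha>: "0 \<le> \<alpha>" using bd by (simp add: A_bound_const_def)
  define B0 where "B0 = (\<lambda>x. S0 x + sF (of_real \<alpha>) (A x))"
  have B0: "p (B0 x) y = p (S0 x) y + of_real \<alpha> * p (A x) y" for x y
    by (simp add: B0_def add_left scale_left)
  have amgm: "2 * Re (p (S0 d) z) \<le> \<alpha> * Re (p (A z) z) + \<alpha> * Re (p (A d) d)"
    and form_ge: "- (\<alpha> * Re (p (A d) d)) \<le> Re (p (S0 d) d)" if "d \<in> D" for d z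
  proof -
    have sq: "(cmod (p (S0 d) y))\<^sup>2 \<le> (\<alpha> * Re (p (A d) d)) * (\<alpha> * Re (p (A y) y))" for y
      using bd that by (simp add: A_bound_const_def power2_eq_square mult_ac)
    have nn: "0 \<le> \<alpha> * Re (p (A y) y)" for y by (simp add: \<alpha> pos)
    have le: "2 * cmod (p (S0 d) y) \<le> \<alpha> * Re (p (A y) y) + \<alpha> * Re (p (A d) d)" for y
    proof (rule power2_le_imp_le)
      have "4 * ((\<alpha> * Re (p (A d) d)) * (\<alpha> * Re (p (A y) y)))
          \<le> (\<alpha> * Re (p (A y) y) + \<alpha> * Re (p (A d) d))\<^sup>2"
        using zero_le_power2[of "\<alpha> * Re (p (A y) y) - \<alpha> * Re (p (A d) d)"]
        by (simp add: power2_eq_square algebra_simps)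
      with sq[of y] show "(2 * cmod (p (S0 d) y))\<^sup>2
          \<le> (\<alpha> * Re (p (A y) y) + \<alpha> * Re (p (A d) d))\<^sup>2"
        by (simp add: power_mult_distrib)
    qed (simp add: nn add_nonneg_nonneg)
    show "2 * Re (p (S0 d) z) \<le> \<alpha> * Re (p (A z) z) + \<alpha> * Re (p (A d) d)"
      using le[of z] complex_Re_le_cmod[of "p (S0 d) z"] by linarith
    show "- (\<alpha> * Re (p (A d) d)) \<le> Re (p (S0 d) d)"
      using le[of d] abs_Re_le_cmod[of "p (S0 d) d"] by linarith
  qed
  interpret B0: positive_form_bounded sE sF p D B0 "\<lambda>x. 2 * \<alpha> * Re (p (A x) x)"
  proof
    show "linear_operator_on sE sF D B0"
      using lin by (auto simp: linear_operator_on_def B0_def A.add A.scale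
          F.scale_right_distrib mult.commute)
    show "symmetric_on p D B0"
      unfolding B0_def
      using symmetric_on_subset[OF A] by (intro symmetric_add symmetric_scale sym) auto
    show "0 \<le> Re (p (B0 d) d)" if "d \<in> D" for d
      using form_ge[OF that] by (simp add: B0)
    \<comment> \<open>Testing the bound of \<open>S0\<close> at \<open>z = 2 x - d\<close> produces exactly the terms of \<open>B0\<close>.\<close>
    show "2 * Re (p (B0 d) x) - Re (p (B0 d) d) \<le> 2 * \<alpha> * Re (p (A x) x)" if "d \<in> D" for d x
      using amgm[OF that, of "x + x - d"] symmetricD[OF A, of x d]
      by (simp add: B0 A.add A.diff add_left add_right diff_left diff_right algebra_simps)
  qed (fact complete D)+
  obtain B where B: "symmetric_on p UNIV B" "extends_op B D B0" "\<And>x. Re (p (B x) x) = B0.Q x"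
    using B0.krein_von_neumann_extension by blast
  define S where "S = (\<lambda>x. B x - sF (of_real \<alpha>) (A x))"
  have S: "p (S x) y = p (B x) y - of_real \<alpha> * p (A x) y" for x y
    by (simp add: S_def diff_left scale_left)
  have symS: "symmetric_on p UNIV S"
    unfolding S_def by (intro symmetric_diff symmetric_scale B(1) A)
  have Q_le: "B0.Q x \<le> 2 * \<alpha> * Re (p (A x) x)" for x
    by (rule B0.Q_least) (simp add: B0.J_def B0.bounded_B0)
  show ?thesis
  proof (intro exI[of _ S] conjI allI impI; (elim conjE)?)
    show "symmetric_on p UNIV S" by (rule symS)
    show "extends_op S D S0"
      using B(2) by (simp add: extends_op_def S_def B0_def)
    show "A_bound_const p A UNIV S \<alpha>"
      unfolding A_bound_const_iff_form_bound[OF symS A pos \<alpha>]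
      using Q_le B0.Q_nonneg by (simp add: S B(3) abs_le_iff algebra_simps)
    fix T x
    assume T: "symmetric_on p UNIV T" and ext: "extends_op T D S0"
      and bT: "A_bound_const p A UNIV T \<alpha>"
    have bT: "- (\<alpha> * Re (p (A y) y)) \<le> Re (p (T y) y)" for y
      using bT[unfolded A_bound_const_iff_form_bound[OF T A pos \<alpha>]]
      by (simp add: abs_le_iff minus_le_iff)
    have "B0.Q x \<le> Re (p (T x) x) + \<alpha> * Re (p (A x) x)"
    proof (rule B0.Q_least)
      fix d assume "d \<in> D"
      then have "S0 d = T d" using ext by (simp add: extends_op_def)
      \<comment> \<open>The form of \<open>T + \<alpha> A\<close> is nonnegative at \<open>d - x\<close>.\<close>
      then show "B0.J x d \<le> Re (p (T x) x) + \<alpha> * Re (p (A x) x)"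
        using bT[of "d - x"] by (simp add: B0.J_def B0 symmetric_form_add[OF T]
            symmetric_form_add[OF A] algebra_simps)
    qed
    then show "Re (p (S x) x) \<le> Re (p (T x) x)" by (simp add: S B(3))
  qed
qed

lemma A_bound_const_uminus: "A_bound_const p A U (\<lambda>x. - S x) \<alpha> \<longleftrightarrow> A_bound_const p A U S \<alpha>"
  by (simp add: A_bound_const_def minus_left)

lemma linear_operator_on_uminus:
  "linear_operator_on sE sF U S \<Longrightarrow> linear_operator_on sE sF U (\<lambda>x. - S x)"
  by (simp add: linear_operator_on_def)

end

text \<open>A bound of an extension is also a bound of the original operator, so the least bound can only
  grow; it stays the same precisely when the old one is still admissible.\<close>

lemma A_bound_extension_eq_iff:
  assumes "positive_op p A" "A_bounded p A D S0" "extends_op S D S0"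
  shows "A_bounded p A UNIV S \<and> A_bound p A UNIV S = A_bound p A D S0
    \<longleftrightarrow> A_bound_const p A UNIV S (A_bound p A D S0)"
proof
  assume "A_bounded p A UNIV S \<and> A_bound p A UNIV S = A_bound p A D S0"
  then show "A_bound_const p A UNIV S (A_bound p A D S0)"
    using A_bound_is_least(1)[OF assms(1)] by metis
next
  assume bd: "A_bound_const p A UNIV S (A_bound p A D S0)"
  then have S: "A_bounded p A UNIV S" by (auto simp: A_bounded_def)
  have "S0 x = S x" if "x \<in> D" for x using that assms(3) by (simp add: extends_op_def)
  then have restrict: "A_bound_const p A D S0 \<beta>" if "A_bound_const p A UNIV S \<beta>" for \<beta>
    using that by (simp add: A_bound_const_def)
  show "A_bounded p A UNIV S \<and> A_bound p A UNIV S = A_bound p A D S0"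
    using S A_bound_is_least(2)[OF assms(1) S bd]
      A_bound_is_least(2)[OF assms(1,2) restrict[OF A_bound_is_least(1)[OF assms(1) S]]]
    by simp
qed

theorem theorem2p1:
  fixes sE :: "complex \<Rightarrow> 'e::ab_group_add \<Rightarrow> 'e"
    and sF :: "complex \<Rightarrow> 'f::ab_group_add \<Rightarrow> 'f"
    and p :: "'f \<Rightarrow> 'e \<Rightarrow> complex"
    and D :: "'e set"
    and S0 A :: "'e \<Rightarrow> 'f"
  assumes "anti_dual_pair sE sF p"
    and "weak_star_sequentially_complete p"
    and "module.subspace sE D"
    and "linear_operator_on sE sF D S0"
    and "symmetric_on p D S0"
    and "A \<in> weakly_continuous_ops sE sF p" and "positive_op p A"
    and "A_bounded p A D S0"
  shows "\<exists>Sm SM.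
    (self_adjoint sE sF p Sm \<and> extends_op Sm D S0 \<and>
      A_bounded p A UNIV Sm \<and> A_bound p A UNIV Sm = A_bound p A D S0) \<and>
    (self_adjoint sE sF p SM \<and> extends_op SM D S0 \<and>
      A_bounded p A UNIV SM \<and> A_bound p A UNIV SM = A_bound p A D S0) \<and>
    op_interval sE sF p Sm SM =
      {S. S \<in> weakly_continuous_ops sE sF p \<and> extends_op S D S0 \<and> self_adjoint sE sF p S \<and>
          A_bounded p A UNIV S \<and> A_bound p A UNIV S = A_bound p A D S0}"
proof -
  interpret anti_dual_pair sE sF p by fact
  define \<alpha> where "\<alpha> = A_bound p A D S0"
  have A: "symmetric_on p UNIV A"
    using assms(6,7) by (intro positive_imp_symmetric) (simp_all add: weakly_continuous_ops_def)
  have pos: "0 \<le> Re (p (A x) x)" for x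
    using assms(7) A by (simp add: symmetric_positive_iff)
  have bd: "A_bound_const p A D S0 \<alpha>"
    unfolding \<alpha>_def by (rule A_bound_is_least(1)) fact+
  then have \<alpha>: "0 \<le> \<alpha>" by (simp add: A_bound_const_def)
  note bound_iff = A_bound_extension_eq_iff[OF assms(7,8), folded \<alpha>_def]
  note form_iff = A_bound_const_iff_form_bound[OF _ A pos \<alpha>]
  obtain Sm where Sm: "symmetric_on p UNIV Sm" "extends_op Sm D S0" "A_bound_const p A UNIV Sm \<alpha>"
    and least: "\<forall>T. symmetric_on p UNIV T \<and> extends_op T D S0 \<and> A_bound_const p A UNIV T \<alpha> \<longrightarrow>
      (\<forall>x. Re (p (Sm x) x) \<le> Re (p (T x) x))"
    using least_extension_with_bound[OF assms(2-5) A pos bd] by blast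
  obtain S' where S': "symmetric_on p UNIV S'" "extends_op S' D (\<lambda>x. - S0 x)"
      "A_bound_const p A UNIV S' \<alpha>"
    and least': "\<forall>T. symmetric_on p UNIV T \<and> extends_op T D (\<lambda>x. - S0 x) \<and>
      A_bound_const p A UNIV T \<alpha> \<longrightarrow> (\<forall>x. Re (p (S' x) x) \<le> Re (p (T x) x))"
    using least_extension_with_bound[OF assms(2,3) linear_operator_on_uminus[OF assms(4)]
        symmetric_uminus[OF assms(5)] A pos A_bound_const_uminus[THEN iffD2, OF bd]] by blast
  define SM where "SM = (\<lambda>x. - S' x)"
  have SM: "symmetric_on p UNIV SM" "extends_op SM D S0" "A_bound_const p A UNIV SM \<alpha>"
    using S' by (simp_all add: SM_def symmetric_uminus A_bound_const_uminus extends_op_def)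
  have greatest: "Re (p (T x) x) \<le> Re (p (SM x) x)"
    if "symmetric_on p UNIV T" "extends_op T D S0" "A_bound_const p A UNIV T \<alpha>" for T x
    using least'[rule_format, of "\<lambda>x. - T x" x] that
    by (simp add: SM_def symmetric_uminus A_bound_const_uminus extends_op_def minus_left)
  have interval: "op_le p Sm S \<and> op_le p S SM \<longleftrightarrow> extends_op S D S0 \<and> A_bound_const p A UNIV S \<alpha>"
    if S: "symmetric_on p UNIV S" for S
  proof
    assume "extends_op S D S0 \<and> A_bound_const p A UNIV S \<alpha>"
    with S least greatest show "op_le p Sm S \<and> op_le p S SM"
      by (simp add: symmetric_op_le_iff Sm SM)
  next
    assume "op_le p Sm S \<and> op_le p S SM"
    then have le: "Re (p (Sm x) x) \<le> Re (p (S x) x)" "Re (p (S x) x) \<le> Re (p (SM x) x)" for x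
      by (simp_all add: symmetric_op_le_iff S Sm SM)
    have "S x = S0 x" if "x \<in> D" for x
    proof -
      have eq: "Sm x = S0 x" "SM x = S0 x" using that Sm(2) SM(2) by (simp_all add: extends_op_def)
      have "symmetric_on p UNIV (\<lambda>x. S x - Sm x)"
        by (intro symmetric_diff S Sm(1))
      then have "S x - Sm x = 0"
        using le le[of x] by (intro form_null_imp_zero) (simp_all add: diff_left eq)
      with eq show ?thesis by simp
    qed
    moreover have "\<bar>Re (p (S x) x)\<bar> \<le> \<alpha> * Re (p (A x) x)" for x
      using le[of x] Sm(3)[unfolded form_iff[OF Sm(1)], rule_format, of x]
        SM(3)[unfolded form_iff[OF SM(1)], rule_format, of x] by linarith
    ultimately show "extends_op S D S0 \<and> A_bound_const p A UNIV S \<alpha>"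
      by (simp add: extends_op_def form_iff[OF S])
  qed
  show ?thesis
  proof (intro exI conjI)
    show "self_adjoint sE sF p Sm" "self_adjoint sE sF p SM"
      using Sm(1) SM(1) by (simp_all add: self_adjoint_iff_symmetric)
    show "extends_op Sm D S0" "extends_op SM D S0" by fact+
    show "A_bounded p A UNIV Sm" "A_bound p A UNIV Sm = A_bound p A D S0"
      "A_bounded p A UNIV SM" "A_bound p A UNIV SM = A_bound p A D S0"
      using bound_iff[OF Sm(2)] bound_iff[OF SM(2)] Sm(3) SM(3) by (simp_all add: \<alpha>_def)
    have "S \<in> op_interval sE sF p Sm SM \<longleftrightarrow> S \<in> weakly_continuous_ops sE sF p \<and>
        extends_op S D S0 \<and> self_adjoint sE sF p S \<and> A_bounded p A UNIV S \<and>
        A_bound p A UNIV S = A_bound p A D S0" for S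
      unfolding op_interval_def
      using interval[of S] bound_iff[of S] self_adjoint_iff[of S] by (auto simp: \<alpha>_def)
    then show "op_interval sE sF p Sm SM =
      {S. S \<in> weakly_continuous_ops sE sF p \<and> extends_op S D S0 \<and> self_adjoint sE sF p S \<and>
          A_bounded p A UNIV S \<and> A_bound p A UNIV S = A_bound p A D S0}"
      by blast
  qed
qed

end
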